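(* Let $X$ be a set of reals. If $X^2$ satisfies $\mathsf{S}_{fin}(\Gamma,\mathrm{T})$, then $X$ satisfies $\mathsf{U}_{fin}(\mathcal{O},\Gamma)$. The corresponding assertions in the Borel and clopen cases also hold: if $X^2$ satisfies $\mathsf{S}_{fin}(\mathcal{B}_\Gamma,\mathcal{B}_{\mathrm T})$, then $X$ satisfies $\mathsf{U}_{fin}(\mathcal{B},\mathcal{B}_\Gamma)$; and if $X^2$ satisfies $\mathsf{S}_{fin}(C_\Gamma,C_{\mathrm T})$, then $X$ satisfies $\mathsf{U}_{fin}(C,C_\Gamma)$.
   Context: A "set of reals" is an infinite, zero-dimensional, separable metrizable topological space $X$; $X^2$ carries the product topology. A cover of $X$ is a family $\mathcal{U}$ of subsets of $X$ with $X\notin\mathcal{U}$ and $X=\bigcup\mathcal{U}$. All covers considered are countable. A cover $\mathcal{U}$ is a $\tau$-cover if $\{U\in\mathcal{U}: x\in U\}$ is infinite for every $x\in X$, and for all $x,y\in X$ either $\{U\in\mathcal{U}: x\in U, y\notin U\}$ is finite or $\{U\in\mathcal{U}: y\in U, x\notin U\}$ is finite. It is a $\gamma$-cover if $\mathcal{U}$ is infinite and $\{U\in\mathcal{U}: x\notin U\}$ is finite for every $x\in X$. $\mathcal{O},\mathrm{T},\Gamma$ denote the collections of all countable open covers, $\tau$-covers, $\gamma$-covers of the space in question; $\mathcal{B},\mathcal{B}_{\mathrm T},\mathcal{B}_\Gamma$ the analogous collections of countable covers by Borel sets; $C,C_{\mathrm T},C_\Gamma$ the analogous collections of countable covers by clopen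 sets. $\mathsf{S}_{fin}(\mathscr{A},\mathscr{B})$: for each sequence $\langle\mathcal{U}_n:n\in\mathbb{N}\rangle$ of members of $\mathscr{A}$ there are finite (possibly empty) $\mathcal{F}_n\subseteq\mathcal{U}_n$, $n\in\mathbb{N}$, such that $\bigcup_{n}\mathcal{F}_n\in\mathscr{B}$. $\mathsf{U}_{fin}(\mathscr{A},\mathscr{B})$: for each sequence $\langle\mathcal{U}_n:n\in\mathbb{N}\rangle$ of members of $\mathscr{A}$ which do not contain a finite subcover, there are finite (possibly empty) $\mathcal{F}_n\subseteq\mathcal{U}_n$, $n\in\mathbb{N}$, such that $\{\bigcup\mathcal{F}_n:n\in\mathbb{N}\}\in\mathscr{B}$. *)

theory Defs
  imports "HOL-Analysis.Analysis"
begin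

definition separable_space :: "'a topology \<Rightarrow> bool" where
  "separable_space X \<longleftrightarrow>
     (\<exists>D. countable D \<and> D \<subseteq> topspace X \<and> X closure_of D = topspace X)"

definition clopenin :: "'a topology \<Rightarrow> 'a set \<Rightarrow> bool" where
  "clopenin X U \<longleftrightarrow> openin X U \<and> closedin X U"

text \<open>Small inductive dimension zero: the clopen sets form a base. Nonemptiness is not
  required here; it follows from infinity in \<open>set_of_reals\<close>.\<close>

definition zero_dimensional :: "'a topology \<Rightarrow> bool" where
  "zero_dimensional X \<longleftrightarrow>
     (\<forall>U x. openin X U \<and> x \<in> U \<longrightarrow> (\<exists>V. clopenin X V \<and> x \<in> V \<and> V \<subseteq> U))"

definition set_of_reals :: "'a topology \<Rightarrow> bool" where
  "set_of_reals X \<longleftrightarrow>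
     infinite (topspace X) \<and> zero_dimensional X \<and> separable_space X \<and> metrizable_space X"

definition open_sets :: "'a topology \<Rightarrow> 'a set set" where
  "open_sets X = {U. openin X U}"

definition borel_sets :: "'a topology \<Rightarrow> 'a set set" where
  "borel_sets X = sigma_sets (topspace X) (open_sets X)"

definition clopen_sets :: "'a topology \<Rightarrow> 'a set set" where
  "clopen_sets X = {U. clopenin X U}"

definition cover :: "'a set \<Rightarrow> 'a set set \<Rightarrow> bool" where
  "cover S \<U> \<longleftrightarrow> \<U> \<subseteq> Pow S \<and> S \<notin> \<U> \<and> \<Union>\<U> = S"

definition tau_cover :: "'a set \<Rightarrow> 'a set set \<Rightarrow> bool" where
  "tau_cover S \<U> \<longleftrightarrow> cover S \<U> \<and>
     (\<forall>x\<in>S. infinite {U \<in> \<U>. x \<in> U}) \<and>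
     (\<forall>x\<in>S. \<forall>y\<in>S. finite {U \<in> \<U>. x \<in> U \<and> y \<notin> U} \<or> finite {U \<in> \<U>. y \<in> U \<and> x \<notin> U})"

definition gamma_cover :: "'a set \<Rightarrow> 'a set set \<Rightarrow> bool" where
  "gamma_cover S \<U> \<longleftrightarrow> cover S \<U> \<and> infinite \<U> \<and> (\<forall>x\<in>S. finite {U \<in> \<U>. x \<notin> U})"

text \<open>Countable covers of \<open>S\<close> whose members all belong to \<open>\<A>\<close> (the open, Borel or clopen sets).\<close>

definition Covers :: "'a set \<Rightarrow> 'a set set \<Rightarrow> 'a set set set" where
  "Covers S \<A> = {\<U>. countable \<U> \<and> \<U> \<subseteq> \<A> \<and> cover S \<U>}"

definition Tau_Covers :: "'a set \<Rightarrow> 'a set set \<Rightarrow> 'a set set set" where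
  "Tau_Covers S \<A> = {\<U>. countable \<U> \<and> \<U> \<subseteq> \<A> \<and> tau_cover S \<U>}"

definition Gamma_Covers :: "'a set \<Rightarrow> 'a set set \<Rightarrow> 'a set set set" where
  "Gamma_Covers S \<A> = {\<U>. countable \<U> \<and> \<U> \<subseteq> \<A> \<and> gamma_cover S \<U>}"

definition S_fin :: "'a set set set \<Rightarrow> 'a set set set \<Rightarrow> bool" where
  "S_fin \<AA> \<BB> \<longleftrightarrow>
     (\<forall>\<U> :: nat \<Rightarrow> 'a set set. (\<forall>n. \<U> n \<in> \<AA>) \<longrightarrow>
        (\<exists>\<F>. (\<forall>n. finite (\<F> n) \<and> \<F> n \<subseteq> \<U> n) \<and> (\<Union>n. \<F> n) \<in> \<BB>))"

text \<open>The space \<open>S\<close> is a parameter because ``finite subcover'' refers to it.\<close>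

definition U_fin :: "'a set \<Rightarrow> 'a set set set \<Rightarrow> 'a set set set \<Rightarrow> bool" where
  "U_fin S \<AA> \<BB> \<longleftrightarrow>
     (\<forall>\<U> :: nat \<Rightarrow> 'a set set.
        (\<forall>n. \<U> n \<in> \<AA> \<and> \<not> (\<exists>\<V>. finite \<V> \<and> \<V> \<subseteq> \<U> n \<and> cover S \<V>)) \<longrightarrow>
        (\<exists>\<F>. (\<forall>n. finite (\<F> n) \<and> \<F> n \<subseteq> \<U> n) \<and> {\<Union>(\<F> n) | n. True} \<in> \<BB>))"

end

theory Submission
  imports Defs
begin

text \<open>
  Let \<open>z \<in> X\<close> and let \<open>V n m\<close> (\<open>m \<in> \<nat>\<close>) be increasing covers of \<open>X\<close> such that \<open>z \<in> V n m\<close>,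
  with \<open>V n m\<close> decreasing in \<open>n\<close> and contained in a finite union of members of the \<open>n\<close>-th given
  cover. The sets \<open>{(x, y). x \<in> V n m \<longrightarrow> y \<in> V n m}\<close> form \<open>\<gamma>\<close>-covers of \<open>X\<^sup>2\<close>. Select a
  \<open>\<tau>\<close>-cover \<open>\<W>\<close> from them and put \<open>N y = {W \<in> \<W>. (z, y) \<in> W}\<close>, an infinite set; the members
  of \<open>\<W>\<close> omitting \<open>(x, y)\<close> form the set \<open>N x - N y\<close>. If \<open>\<W> - N a\<close> is infinite for some \<open>a\<close>,
  then for every \<open>y\<close> the comparability of \<open>(z, a)\<close> and \<open>(a, y)\<close>, which are omitted by the disjoint
  sets \<open>\<W> - N a\<close> and \<open>N a - N y\<close>, forces \<open>N a - N y\<close> to be finite. Hence \<open>N a\<close> (or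
  \<open>\<W>\<close> itself) is an infinite family that is almost contained in every \<open>N y\<close>. Since \<open>V n m\<close>
  decreases in \<open>n\<close>, this infinite family provides a choice at every \<open>n\<close>. As the sets in \<open>X\<^sup>2\<close>
  involve complements, open covers are first refined to clopen ones by zero-dimensionality.
\<close>

section \<open>Implication relations on the square\<close>

text \<open>For \<open>V \<subseteq> S\<close> these are the pairs with
  \<open>x \<in> V \<longrightarrow> y \<in> V\<close>; the form as a union of two rectangles makes
  clopenness in the square visible.\<close>

definition impl_set :: "'a set \<Rightarrow> 'a set \<Rightarrow> ('a \<times> 'a) set" where
  "impl_set S V = S \<times> V \<union> (S - V) \<times> S"

lemma tau_cover_impl_sets_pseudointersection:
  assumes tau: "tau_cover (S \<times> S) \<W>" and z: "z \<in> S"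
    and impl: "\<And>W. W \<in> \<W> \<Longrightarrow> \<exists>V. z \<in> V \<and> V \<subseteq> S \<and> W = impl_set S V"
  shows "\<exists>\<C>\<subseteq>\<W>. infinite \<C> \<and> (\<forall>y\<in>S. finite {W \<in> \<C>. (z, y) \<notin> W})"
proof -
  \<comment> \<open>As \<open>z \<in> V\<close>, the pair \<open>(z, y)\<close> lies in
    \<open>W\<close> iff \<open>y \<in> V\<close>; so the section over \<open>z\<close> determines
    all of \<open>W\<close>.\<close>
  have mem: "(x, y) \<in> W \<longleftrightarrow> (z, y) \<in> W \<or> (z, x) \<notin> W"
    if "W \<in> \<W>" "x \<in> S" "y \<in> S" for W x y
    using impl[OF that(1)] that z by (auto simp: impl_set_def)
  have inf: "infinite {W \<in> \<W>. p \<in> W}" if "p \<in> S \<times> S" for p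
    using tau that unfolding tau_cover_def by blast
  have comparable: "finite {W \<in> \<W>. p \<in> W \<and> q \<notin> W} \<or> finite {W \<in> \<W>. q \<in> W \<and> p \<notin> W}"
    if "p \<in> S \<times> S" "q \<in> S \<times> S" for p q
    using tau that unfolding tau_cover_def by blast
  show ?thesis
  proof (cases "\<forall>y\<in>S. finite {W \<in> \<W>. (z, y) \<notin> W}")
    case True
    have "infinite \<W>"
      using inf[of "(z, z)"] z by auto
    then show ?thesis using True by blast
  next
    case False
    then obtain a where a: "a \<in> S" and infa: "infinite {W \<in> \<W>. (z, a) \<notin> W}" by blast
    define \<C> where "\<C> = {W \<in> \<W>. (z, a) \<in> W}"
    have "finite {W \<in> \<C>. (z, y) \<notin> W}" if y: "y \<in> S" for y
    proof -
      \<comment> \<open>A set omitting \<open>(z, a)\<close> has \<open>a \<notin> V\<close> and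
        contains \<open>(a, y)\<close> vacuously; this rules out one alternative of
        comparability.\<close>
      have "{W \<in> \<W>. (a, y) \<in> W \<and> (z, a) \<notin> W} = {W \<in> \<W>. (z, a) \<notin> W}"
        using mem a y by auto
      then have "finite {W \<in> \<W>. (z, a) \<in> W \<and> (a, y) \<notin> W}"
        using comparable[of "(z, a)" "(a, y)"] a y z infa by auto
      moreover have "{W \<in> \<W>. (z, a) \<in> W \<and> (a, y) \<notin> W} = {W \<in> \<C>. (z, y) \<notin> W}"
        using mem a y by (auto simp: \<C>_def)
      ultimately show ?thesis by simp
    qed
    moreover have "infinite \<C>" using inf[of "(z, a)"] a z by (simp add: \<C>_def)
    ultimately show ?thesis by (intro exI[of _ \<C>]) (auto simp: \<C>_def)
  qed
qed

text \<open>A finite nonempty chain contains its own union, which here would be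
  \<open>S\<close>.\<close>

lemma infinite_range_if_mono_exhausting:
  fixes V :: "nat \<Rightarrow> 'a set"
  assumes "mono V" and un: "(\<Union>m. V m) = S" and proper: "\<And>m. V m \<noteq> S"
  shows "infinite (range V)"
proof
  assume "finite (range V)"
  have "\<Union>(range V) \<in> range V"
  proof (rule finite_Sup_in[OF \<open>finite (range V)\<close>])
    fix A B assume "A \<in> range V" "B \<in> range V"
    then obtain i j where "A = V i" "B = V j" by blast
    then have "sup A B = V (max i j)"
      using \<open>mono V\<close> by (metis max_of_mono sup_max sup_absorb1 sup_absorb2 max_def le_cases monoD)
    then show "sup A B \<in> range V" by simp
  qed simp
  then show False using un proper by auto
qed

text \<open>A pair lies in \<open>impl_set S (V m)\<close> once \<open>V m\<close> contains its
  second coordinate, hence for all large \<open>m\<close>. The section over \<open>z\<close>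
  recovers \<open>V m\<close>, so these sets are infinitely many and proper.\<close>

lemma gamma_cover_impl_sets:
  fixes V :: "nat \<Rightarrow> 'a set"
  assumes "mono V" and un: "(\<Union>m. V m) = S" and proper: "\<And>m. V m \<noteq> S" and z: "\<And>m. z \<in> V m"
  shows "gamma_cover (S \<times> S) (range (\<lambda>m. impl_set S (V m)))"
proof -
  let ?P = "\<lambda>m. impl_set S (V m)"
  have sub: "V m \<subseteq> S" for m using un by blast
  have zS: "z \<in> S" using z sub by blast
  have slice: "Pair z -` impl_set S (V m) = V m" for m
    using z[of m] sub[of m] zS by (auto simp: impl_set_def)
  have "range V = (\<lambda>W. Pair z -` W) ` range ?P"
    by (simp add: image_image slice)
  then have inf: "infinite (range ?P)"
    using infinite_range_if_mono_exhausting[OF assms(1-3)] finite_imageI by metis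
  have ev: "\<exists>k. \<forall>m\<ge>k. p \<in> ?P m" if p: "p \<in> S \<times> S" for p
  proof -
    obtain k where k: "snd p \<in> V k" using p un by auto
    then have "snd p \<in> V m" if "m \<ge> k" for m using monoD[OF \<open>mono V\<close> that] by blast
    then show ?thesis using p by (intro exI[of _ k]) (auto simp: impl_set_def mem_Times_iff)
  qed
  have fin: "finite {U \<in> range ?P. p \<notin> U}" if p: "p \<in> S \<times> S" for p
  proof -
    obtain k where k: "\<And>m. m \<ge> k \<Longrightarrow> p \<in> ?P m" using ev[OF p] by blast
    have "{U \<in> range ?P. p \<notin> U} \<subseteq> ?P ` {..<k}"
    proof
      fix U assume "U \<in> {U \<in> range ?P. p \<notin> U}"
      then obtain m where m: "U = ?P m" "p \<notin> ?P m" by blast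
      then have "m < k" using k not_le by blast
      then show "U \<in> ?P ` {..<k}" using m by blast
    qed
    then show ?thesis by (rule finite_subset) auto
  qed
  have "S \<times> S \<noteq> ?P m" for m
  proof
    assume "S \<times> S = ?P m"
    then have "Pair z -` (S \<times> S) = V m" using slice by simp
    then show False using proper[of m] zS by auto
  qed
  moreover have "?P m \<subseteq> S \<times> S" for m using sub by (auto simp: impl_set_def)
  moreover have "S \<times> S \<subseteq> \<Union>(range ?P)" using ev by blast
  ultimately have "cover (S \<times> S) (range ?P)" unfolding cover_def by blast
  then show ?thesis using inf fin unfolding gamma_cover_def by blast
qed

text \<open>The range is infinite because a value taken at infinitely many indices would contain
  every point of \<open>S\<close>.\<close>

lemma gamma_cover_range:
  fixes G :: "nat \<Rightarrow> 'a set"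
  assumes sub: "\<And>k. G k \<subseteq> S" and proper: "\<And>k. G k \<noteq> S"
    and fin: "\<And>x. x \<in> S \<Longrightarrow> finite {k. x \<notin> G k}"
  shows "gamma_cover S (range G)"
proof -
  have "infinite (range G)"
  proof
    assume "finite (range G)"
    then obtain i where inf: "infinite {k. G k = G i}"
      using pigeonhole_infinite[of UNIV G] by auto
    have "x \<in> G i" if x: "x \<in> S" for x
    proof (rule ccontr)
      assume "x \<notin> G i"
      then have "{k. G k = G i} \<subseteq> {k. x \<notin> G k}" by auto
      then show False using fin[OF x] inf finite_subset by blast
    qed
    then show False using sub[of i] proper[of i] by blast
  qed
  moreover have "finite {U \<in> range G. x \<notin> U}" if "x \<in> S" for x
  proof -
    have "{U \<in> range G. x \<notin> U} \<subseteq> G ` {k. x \<notin> G k}" by auto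
    then show ?thesis using fin[OF that] finite_surj by blast
  qed
  moreover have "S \<subseteq> \<Union>(range G)"
  proof
    fix x assume "x \<in> S"
    then have "{k. x \<notin> G k} \<noteq> UNIV" using fin infinite_UNIV_nat by metis
    then show "x \<in> \<Union>(range G)" by auto
  qed
  ultimately show ?thesis
    using sub proper unfolding gamma_cover_def cover_def by blast
qed

section \<open>Transfer from the square to the space\<close>

text \<open>Serves all three cases: \<open>\<A>\<close> and \<open>\<A>2\<close> are the classes of
  sets allowed in covers of \<open>S\<close> and of its square, and \<open>\<D>\<close> supplies
  refinements closed under complement, namely clopen ones for open covers.\<close>

lemma U_fin_if_S_fin_square:
  fixes S :: "'a set"
  assumes alg: "algebra S \<D>" and z: "z \<in> S"
    and Union\<A>: "\<And>\<F>. finite \<F> \<Longrightarrow> \<F> \<subseteq> \<A> \<Longrightarrow> \<Union>\<F> \<in> \<A>"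
    and refine: "\<And>\<U>. \<U> \<in> Covers S \<A> \<Longrightarrow>
      \<exists>D :: nat \<Rightarrow> 'a set. range D \<subseteq> \<D> \<and> (\<Union>j. D j) = S \<and> (\<forall>j. \<exists>U\<in>\<U>. D j \<subseteq> U)"
    and square: "\<And>V. V \<in> \<D> \<Longrightarrow> impl_set S V \<in> \<A>2"
    and S_fin: "S_fin (Gamma_Covers (S \<times> S) \<A>2) (Tau_Covers (S \<times> S) \<A>2)"
  shows "U_fin S (Covers S \<A>) (Gamma_Covers S \<A>)"
  unfolding U_fin_def
proof (intro allI impI)
  interpret algebra S \<D> by (rule alg)
  fix \<U> :: "nat \<Rightarrow> 'a set set"
  assume *: "\<forall>n. \<U> n \<in> Covers S \<A> \<and> \<not> (\<exists>\<V>. finite \<V> \<and> \<V> \<subseteq> \<U> n \<and> cover S \<V>)"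
  have cov: "cover S (\<U> n)" and sub\<A>: "\<U> n \<subseteq> \<A>" for n using * by (auto simp: Covers_def)
  \<comment> \<open>Since \<open>S \<notin> \<U> n\<close>, a finite subfamily with union
    \<open>S\<close> would be a finite subcover in the sense of \<open>cover\<close>.\<close>
  have nofin: "\<Union>\<V> \<noteq> S" if "finite \<V>" "\<V> \<subseteq> \<U> n" for \<V> n
  proof
    assume "\<Union>\<V> = S"
    moreover have "\<V> \<subseteq> Pow S" "S \<notin> \<V>" using cov[of n] that(2) by (auto simp: cover_def)
    ultimately have "cover S \<V>" by (simp add: cover_def)
    moreover have "\<not> (\<exists>\<V>. finite \<V> \<and> \<V> \<subseteq> \<U> n \<and> cover S \<V>)" using * by simp
    ultimately show False using that by blast
  qed
  obtain D :: "nat \<Rightarrow> nat \<Rightarrow> 'a set" where D: "\<And>n j. D n j \<in> \<D>" and UD: "\<And>n. (\<Union>j. D n j) = S"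
    and DU: "\<And>n j. \<exists>U\<in>\<U> n. D n j \<subseteq> U"
  proof -
    have "\<forall>n. \<exists>D :: nat \<Rightarrow> 'a set.
        range D \<subseteq> \<D> \<and> (\<Union>j. D j) = S \<and> (\<forall>j. \<exists>U\<in>\<U> n. D j \<subseteq> U)"
      using refine * by blast
    then obtain D :: "nat \<Rightarrow> nat \<Rightarrow> 'a set"
      where "\<forall>n. range (D n) \<subseteq> \<D> \<and> (\<Union>j. D n j) = S \<and> (\<forall>j. \<exists>U\<in>\<U> n. D n j \<subseteq> U)"
      by metis
    then show thesis by (intro that[of D]) blast+
  qed
  obtain u where u: "\<And>n j. u n j \<in> \<U> n" and Du: "\<And>n j. D n j \<subseteq> u n j"
    using DU by metis
  have D_index: "\<exists>j. \<forall>i. x \<in> D i (j i)" if "x \<in> S" for x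
  proof (rule choice, rule allI)
    show "\<exists>j. x \<in> D i j" for i using UD[of i] that by blast
  qed
  \<comment> \<open>The shift by \<open>c n\<close> in \<open>E\<close> puts \<open>z\<close> into
    \<open>E n m\<close> already for \<open>m = 0\<close>.\<close>
  then obtain c where c: "\<And>n. z \<in> D n (c n)" using z by blast
  define E where "E n m = (\<Union>j\<le>m + c n. D n j)" for n m
  \<comment> \<open>Intersecting over \<open>i \<le> n\<close> makes \<open>V n m\<close> decrease
    in \<open>n\<close>, so a set chosen at a late stage serves every earlier one.\<close>
  define V where "V n m = (\<Inter>i\<le>n. E i m)" for n m
  have V\<D>: "V n m \<in> \<D>" for n m
    unfolding V_def E_def by (intro finite_INT finite_UN D) auto
  have E_mono: "E n m \<subseteq> E n m'" if "m \<le> m'" for n m m'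
    using that unfolding E_def by (intro UN_mono) auto
  have V_mono: "mono (V n)" for n
    unfolding V_def by (intro monoI INF_mono' E_mono)
  have zV: "z \<in> V n m" for n m
  proof -
    have "z \<in> E i m" for i unfolding E_def using c[of i] by (intro UN_I[of "c i"]) auto
    then show ?thesis by (simp add: V_def)
  qed
  have V_sub: "V n m \<subseteq> S" for n m using V\<D> sets_into_space by blast
  have V_u: "V n m \<subseteq> \<Union>(u k ` {..m + c k})" if "k \<le> n" for n m k
  proof -
    have "V n m \<subseteq> E k m" using that unfolding V_def by blast
    also have "\<dots> \<subseteq> \<Union>(u k ` {..m + c k})" unfolding E_def by (intro UN_mono Du) auto
    finally show ?thesis .
  qed
  have V_proper: "V n m \<noteq> S" for n m
  proof
    assume "V n m = S"
    moreover have "\<Union>(u n ` {..m + c n}) \<subseteq> S" using u cov unfolding cover_def by blast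
    ultimately have "\<Union>(u n ` {..m + c n}) = S" using V_u[of n n m] by blast
    then show False using nofin[of "u n ` {..m + c n}" n] u by auto
  qed
  have UV: "(\<Union>m. V n m) = S" for n
  proof
    show "S \<subseteq> (\<Union>m. V n m)"
    proof
      fix x assume "x \<in> S"
      then obtain j where j: "\<And>i. x \<in> D i (j i)" using D_index by blast
      have "x \<in> E i (Max (j ` {..n}))" if "i \<le> n" for i
      proof -
        have "j i \<le> Max (j ` {..n})" using that by auto
        then show ?thesis using j[of i] unfolding E_def by (intro UN_I[of "j i"]) auto
      qed
      then show "x \<in> (\<Union>m. V n m)" unfolding V_def by blast
    qed
  qed (use V_sub in blast)
  define P where "P n = range (\<lambda>m. impl_set S (V n m))" for n
  have "P n \<in> Gamma_Covers (S \<times> S) \<A>2" for n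
    using gamma_cover_impl_sets[OF V_mono UV V_proper zV] square V\<D>
    by (auto simp: Gamma_Covers_def P_def)
  then have "\<exists>\<H>. (\<forall>n. finite (\<H> n) \<and> \<H> n \<subseteq> P n) \<and> (\<Union>n. \<H> n) \<in> Tau_Covers (S \<times> S) \<A>2"
    using S_fin unfolding S_fin_def by simp
  then obtain \<H> where \<H>: "\<forall>n. finite (\<H> n) \<and> \<H> n \<subseteq> P n"
    and "(\<Union>n. \<H> n) \<in> Tau_Covers (S \<times> S) \<A>2"
    by (elim exE conjE)
  then have fin\<H>: "finite (\<H> n)" and \<H>P: "\<H> n \<subseteq> P n"
    and tau: "tau_cover (S \<times> S) (\<Union>n. \<H> n)" for n
    by (simp_all add: Tau_Covers_def)
  have impl: "\<exists>V. z \<in> V \<and> V \<subseteq> S \<and> W = impl_set S V" if W: "W \<in> (\<Union>n. \<H> n)" for W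
  proof -
    obtain n where "W \<in> \<H> n" using W by blast
    then have "W \<in> P n" using \<H>P[of n] by blast
    then obtain m where "W = impl_set S (V n m)" unfolding P_def by (elim rangeE)
    then show ?thesis using V_sub zV by (intro exI[of _ "V n m"]) simp
  qed
  have "\<exists>\<C>\<subseteq>\<Union>n. \<H> n. infinite \<C> \<and> (\<forall>y\<in>S. finite {W \<in> \<C>. (z, y) \<notin> W})"
    by (rule tau_cover_impl_sets_pseudointersection[OF tau z]) (rule impl)
  then obtain \<C> where \<C>: "\<C> \<subseteq> (\<Union>n. \<H> n)" and inf\<C>: "infinite \<C>"
    and fin\<C>: "\<forall>y\<in>S. finite {W \<in> \<C>. (z, y) \<notin> W}"
    by (elim exE conjE)
  \<comment> \<open>Finitely many finite selections cannot exhaust \<open>\<C>\<close>; a set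
    outside the first \<open>k\<close> of them comes from a stage \<open>n \<ge> k\<close>.\<close>
  have "\<exists>W. W \<in> \<C> \<and> W \<notin> (\<Union>n<k. \<H> n)" for k
  proof -
    have "finite (\<Union>n<k. \<H> n)" using fin\<H> by simp
    then have "\<not> \<C> \<subseteq> (\<Union>n<k. \<H> n)" using inf\<C> finite_subset by blast
    then show ?thesis by blast
  qed
  then obtain w where w\<C>: "\<And>k. w k \<in> \<C>" and w: "\<And>k. w k \<notin> (\<Union>n<k. \<H> n)" by metis
  have "\<exists>m. \<exists>n\<ge>k. w k = impl_set S (V n m)" for k
  proof -
    obtain n where n: "w k \<in> \<H> n" using subsetD[OF \<C> w\<C>[of k]] by blast
    then have "k \<le> n" using w[of k] by (meson UN_I lessThan_iff not_le)
    moreover obtain m where "w k = impl_set S (V n m)" using n \<H>P[of n] unfolding P_def by blast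
    ultimately show ?thesis by blast
  qed
  then obtain m n where n: "\<And>k. n k \<ge> k" and wV: "\<And>k. w k = impl_set S (V (n k) (m k))"
    by metis
  \<comment> \<open>\<open>w\<close> may repeat, but a set selected at stage \<open>i\<close> cannot
    be \<open>w k\<close> for \<open>k > i\<close>.\<close>
  have fibre: "finite {k. w k = W}" for W
  proof (cases "\<exists>k. w k = W")
    case True
    then obtain k where k: "w k = W" by blast
    obtain i where i: "W \<in> \<H> i" unfolding k[symmetric] using subsetD[OF \<C> w\<C>[of k]] by blast
    have "{k. w k = W} \<subseteq> {..i}"
    proof
      fix k assume "k \<in> {k. w k = W}"
      then show "k \<in> {..i}" using i w[of k] by (auto simp: not_less)
    qed
    then show ?thesis using finite_subset by blast
  qed simp
  \<comment> \<open>Since \<open>k \<le> n k\<close>, the union of these members of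
    \<open>\<U> k\<close> contains \<open>V (n k) (m k)\<close>.\<close>
  define \<F> where "\<F> k = u k ` {..m k + c k}" for k
  have \<F>: "finite (\<F> k)" "\<F> k \<subseteq> \<U> k" for k using u by (auto simp: \<F>_def)
  have "finite {k. x \<notin> \<Union>(\<F> k)}" if x: "x \<in> S" for x
  proof -
    \<comment> \<open>Thus the indices missing \<open>x\<close> lie in the fibres of
      \<open>w\<close> over the finitely many members of \<open>\<C>\<close> that omit
      \<open>(z, x)\<close>.\<close>
    have "(z, x) \<notin> w k" if "x \<notin> \<Union>(\<F> k)" for k
      using that V_u[OF n[of k], of "m k"] zV[of "n k" "m k"] by (auto simp: wV impl_set_def \<F>_def)
    then have "{k. x \<notin> \<Union>(\<F> k)} \<subseteq> (\<Union>W\<in>{W \<in> \<C>. (z, x) \<notin> W}. {k. w k = W})"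
      using w\<C> by blast
    then show ?thesis using fin\<C> x fibre by (meson finite_UN_I finite_subset)
  qed
  moreover have "\<Union>(\<F> k) \<subseteq> S" for k
    using \<F>(2)[of k] cov[of k] unfolding cover_def by blast
  moreover have "\<Union>(\<F> k) \<noteq> S" for k using nofin \<F> .
  ultimately have "gamma_cover S (range (\<lambda>k. \<Union>(\<F> k)))"
    by (intro gamma_cover_range)
  moreover have "range (\<lambda>k. \<Union>(\<F> k)) \<subseteq> \<A>"
    by (intro image_subsetI Union\<A> \<F>(1) subset_trans[OF \<F>(2) sub\<A>])
  ultimately have "range (\<lambda>k. \<Union>(\<F> k)) \<in> Gamma_Covers S \<A>" by (simp add: Gamma_Covers_def)
  then show "\<exists>\<F>. (\<forall>n. finite (\<F> n) \<and> \<F> n \<subseteq> \<U> n) \<and> {\<Union>(\<F> n) |n. True} \<in> Gamma_Covers S \<A>"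
    using \<F> by (intro exI[of _ \<F>]) (simp add: full_SetCompr_eq)
qed

section \<open>Refinements of countable covers\<close>

text \<open>In the Borel and clopen cases a cover is its own refinement, enumerated with repetitions
  if finite.\<close>

lemma Covers_enumeration:
  assumes "\<U> \<in> Covers S \<A>" "S \<noteq> {}"
  shows "\<exists>D :: nat \<Rightarrow> 'a set. range D \<subseteq> \<A> \<and> (\<Union>j. D j) = S \<and> (\<forall>j. \<exists>U\<in>\<U>. D j \<subseteq> U)"
proof -
  have "\<U> \<noteq> {}" "countable \<U>" "\<U> \<subseteq> \<A>" "\<Union>\<U> = S"
    using assms by (auto simp: Covers_def cover_def)
  then show ?thesis
    by (intro exI[of _ "from_nat_into \<U>"]) (auto simp: range_from_nat_into from_nat_into)
qed

text \<open>For each ball of radius \<open>1 / Suc i\<close> about a point of a countable dense set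
  that fits into a member of the cover, one such member is kept.\<close>

lemma Lindelof_space_separable_metrizable:
  assumes "metrizable_space X" "separable_space X"
  shows "Lindelof_space X"
  unfolding Lindelof_space_def
proof (intro allI impI)
  fix \<U> assume \<U>: "(\<forall>U\<in>\<U>. openin X U) \<and> \<Union>\<U> = topspace X"
  obtain M d where "Metric_space M d" and X: "X = Metric_space.mtopology M d"
    using assms(1) unfolding metrizable_space_def by blast
  then interpret Metric_space M d by simp
  obtain D where D: "countable D" "D \<subseteq> M" "mtopology closure_of D = M"
    using assms(2) by (auto simp: separable_space_def X)
  define I where "I = {(a, i :: nat). a \<in> D \<and> (\<exists>U\<in>\<U>. mball a (1 / Suc i) \<subseteq> U)}"
  obtain s where s: "\<And>a i. (a, i) \<in> I \<Longrightarrow> s (a, i) \<in> \<U> \<and> mball a (1 / Suc i) \<subseteq> s (a, i)"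
  proof -
    have "\<forall>p\<in>I. \<exists>U. U \<in> \<U> \<and> mball (fst p) (1 / Suc (snd p)) \<subseteq> U"
      unfolding I_def by auto
    then obtain s where "\<forall>p\<in>I. s p \<in> \<U> \<and> mball (fst p) (1 / Suc (snd p)) \<subseteq> s p"
      by metis
    then show thesis by (intro that[of s]) force
  qed
  have "countable I"
    by (rule countable_subset[of _ "D \<times> UNIV"]) (auto simp: I_def D)
  moreover have "s ` I \<subseteq> \<U>" using s by auto
  moreover have "topspace X \<subseteq> \<Union>(s ` I)"
  proof
    fix x assume "x \<in> topspace X"
    then obtain U where U: "U \<in> \<U>" "x \<in> U" using \<U> by blast
    then have xM: "x \<in> M" and "openin mtopology U" using \<U> by (auto simp: X)
    then obtain r where r: "r > 0" "mball x r \<subseteq> U"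
      using U by (meson openin_mtopology)
    \<comment> \<open>With radius below \<open>r / 2\<close>, a ball whose centre is that close to
      \<open>x\<close> contains \<open>x\<close> and stays in \<open>mball x r\<close>.\<close>
    obtain i where i: "1 / Suc i < r / 2"
      using r reals_Archimedean[of "r / 2"] by (auto simp: inverse_eq_divide)
    have "x \<in> mtopology closure_of D" using xM D by simp
    then have "\<forall>r>0. \<exists>a\<in>D. a \<in> mball x r"
      by (simp add: metric_closure_of del: in_mball)
    then obtain a where a: "a \<in> D" "a \<in> mball x (1 / Suc i)"
      using zero_less_divide_1_iff of_nat_0_less_iff zero_less_Suc by metis
    have "mball a (1 / Suc i) \<subseteq> mball x r"
      using a(2) i by (intro mball_subset) (auto simp: commute)
    then have "(a, i) \<in> I" using a r U by (auto simp: I_def)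
    moreover have "x \<in> mball a (1 / Suc i)" using a(2) by (simp add: commute)
    ultimately show "x \<in> \<Union>(s ` I)" using s by blast
  qed
  moreover have "\<Union>(s ` I) \<subseteq> topspace X" using \<open>s ` I \<subseteq> \<U>\<close> \<U> by (metis Union_mono)
  ultimately show "\<exists>\<V>. countable \<V> \<and> \<V> \<subseteq> \<U> \<and> \<Union>\<V> = topspace X"
    by (intro exI[of _ "s ` I"]) simp
qed

text \<open>Zero-dimensionality gives a clopen refinement, and the Lindelof property a countable
  part of it that still covers.\<close>

lemma open_cover_clopen_refinement:
  assumes X: "set_of_reals X" and \<U>: "\<U> \<in> Covers (topspace X) (open_sets X)"
  shows "\<exists>D :: nat \<Rightarrow> 'a set. range D \<subseteq> clopen_sets X \<and> (\<Union>j. D j) = topspace X \<and>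
    (\<forall>j. \<exists>U\<in>\<U>. D j \<subseteq> U)"
proof -
  define \<V> where "\<V> = {V. clopenin X V \<and> (\<exists>U\<in>\<U>. V \<subseteq> U)}"
  have "topspace X \<subseteq> \<Union>\<V>"
  proof
    fix x assume "x \<in> topspace X"
    then obtain U where "U \<in> \<U>" "x \<in> U" "openin X U"
      using \<U> unfolding Covers_def cover_def open_sets_def by blast
    moreover then obtain V where "clopenin X V" "x \<in> V" "V \<subseteq> U"
      using X unfolding set_of_reals_def zero_dimensional_def by blast
    ultimately show "x \<in> \<Union>\<V>" unfolding \<V>_def by blast
  qed
  then obtain \<V>' where \<V>': "countable \<V>'" "\<V>' \<subseteq> \<V>" "\<Union>\<V>' = topspace X"
    using Lindelof_spaceD[of X \<V>] Lindelof_space_separable_metrizable X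
    unfolding set_of_reals_def \<V>_def clopenin_def
    by (smt (verit) Union_least mem_Collect_eq openin_subset subset_antisym)
  moreover have "\<V>' \<noteq> {}" using \<V>'(3) X by (auto simp: set_of_reals_def)
  ultimately have "range (from_nat_into \<V>') = \<V>'" by simp
  then show ?thesis
    using \<V>' unfolding \<V>_def clopen_sets_def
    by (intro exI[of _ "from_nat_into \<V>'"]) (smt (verit) mem_Collect_eq rangeI subset_iff)
qed

section \<open>Clopen and Borel sets in the square\<close>

lemma algebra_clopen_sets: "algebra (topspace X) (clopen_sets X)"
  unfolding algebra_iff_Un clopen_sets_def clopenin_def
  by (auto dest: openin_subset)

lemma algebra_borel_sets: "algebra (topspace X) (borel_sets X)"
proof -
  have "sigma_algebra (topspace X) (borel_sets X)"
    unfolding borel_sets_def open_sets_def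
    by (rule sigma_algebra_sigma_sets) (auto dest: openin_subset)
  then show ?thesis by (simp add: sigma_algebra_iff)
qed

lemma clopen_impl_set:
  assumes "V \<in> clopen_sets X"
  shows "impl_set (topspace X) V \<in> clopen_sets (prod_topology X X)"
  using assms unfolding impl_set_def clopen_sets_def clopenin_def
  by (auto intro!: openin_Un closedin_Un openin_diff closedin_diff
      simp: openin_prod_Times_iff closedin_prod_Times_iff)

text \<open>Preimages commute with generating a sigma-algebra, and preimages of open sets are
  open.\<close>

lemma borel_sets_continuous_vimage:
  assumes f: "continuous_map Y X f" and V: "V \<in> borel_sets X"
  shows "f -` V \<inter> topspace Y \<in> borel_sets Y"
proof -
  have "f \<in> topspace Y \<rightarrow> topspace X" using f continuous_map_funspace by blast
  then have "{f -` A \<inter> topspace Y |A. A \<in> sigma_sets (topspace X) (open_sets X)}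
      = sigma_sets (topspace Y) {f -` A \<inter> topspace Y |A. A \<in> open_sets X}"
    by (rule sigma_sets_vimage_commute)
  then have mem: "f -` V \<inter> topspace Y \<in> sigma_sets (topspace Y) {f -` A \<inter> topspace Y |A. A \<in> open_sets X}"
    using V unfolding borel_sets_def by blast
  have "openin Y (f -` A \<inter> topspace Y)" if "openin X A" for A
    using openin_continuous_map_preimage[OF f that] by (simp add: vimage_def Int_def conj_commute)
  then have "{f -` A \<inter> topspace Y |A. A \<in> open_sets X} \<subseteq> open_sets Y"
    by (auto simp: open_sets_def)
  then have "sigma_sets (topspace Y) {f -` A \<inter> topspace Y |A. A \<in> open_sets X} \<subseteq> borel_sets Y"
    unfolding borel_sets_def by (rule sigma_sets_mono')
  then show ?thesis using mem by (rule subsetD)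
qed

lemma borel_impl_set:
  assumes V: "V \<in> borel_sets X"
  shows "impl_set (topspace X) V \<in> borel_sets (prod_topology X X)"
proof -
  interpret X: algebra "topspace X" "borel_sets X" by (rule algebra_borel_sets)
  interpret X2: algebra "topspace (prod_topology X X)" "borel_sets (prod_topology X X)"
    by (rule algebra_borel_sets)
  have "V \<subseteq> topspace X" using V X.sets_into_space by blast
  \<comment> \<open>The two rectangles are preimages under the continuous projections.\<close>
  then have "impl_set (topspace X) V =
      (snd -` V \<inter> topspace (prod_topology X X)) \<union>
      (fst -` (topspace X - V) \<inter> topspace (prod_topology X X))"
    by (auto simp: impl_set_def)
  then show ?thesis
    using borel_sets_continuous_vimage[OF continuous_map_snd V]
      borel_sets_continuous_vimage[OF continuous_map_fst X.compl_sets[OF V]]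
    by (metis X2.Un)
qed

theorem theorem2p9:
  fixes X :: "'a topology"
  assumes "set_of_reals X"
  defines "X2 \<equiv> prod_topology X X"
  shows
    "(S_fin (Gamma_Covers (topspace X2) (open_sets X2)) (Tau_Covers (topspace X2) (open_sets X2))
        \<longrightarrow> U_fin (topspace X) (Covers (topspace X) (open_sets X))
                               (Gamma_Covers (topspace X) (open_sets X))) \<and>
     (S_fin (Gamma_Covers (topspace X2) (borel_sets X2)) (Tau_Covers (topspace X2) (borel_sets X2))
        \<longrightarrow> U_fin (topspace X) (Covers (topspace X) (borel_sets X))
                               (Gamma_Covers (topspace X) (borel_sets X))) \<and>
     (S_fin (Gamma_Covers (topspace X2) (clopen_sets X2)) (Tau_Covers (topspace X2) (clopen_sets X2))
        \<longrightarrow> U_fin (topspace X) (Covers (topspace X) (clopen_sets X))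
                               (Gamma_Covers (topspace X) (clopen_sets X)))"
proof -
  have ne: "topspace X \<noteq> {}" using assms(1) by (auto simp: set_of_reals_def)
  then obtain z where z: "z \<in> topspace X" by blast
  interpret B: algebra "topspace X" "borel_sets X" by (rule algebra_borel_sets)
  interpret C: algebra "topspace X" "clopen_sets X" by (rule algebra_clopen_sets)
  have top: "topspace X2 = topspace X \<times> topspace X" by (simp add: X2_def)
  have clopenI: "impl_set (topspace X) V \<in> clopen_sets X2" if "V \<in> clopen_sets X" for V
    using clopen_impl_set[OF that] by (simp add: X2_def)
  have openI: "impl_set (topspace X) V \<in> open_sets X2" if "V \<in> clopen_sets X" for V
    using clopenI[OF that] by (auto simp: clopen_sets_def clopenin_def open_sets_def)
  have borelI: "impl_set (topspace X) V \<in> borel_sets X2" if "V \<in> borel_sets X" for V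
    using borel_impl_set[OF that] by (simp add: X2_def)
  have open_Union: "\<Union>\<F> \<in> open_sets X" if "finite \<F>" "\<F> \<subseteq> open_sets X" for \<F>
    using that by (auto simp: open_sets_def)
  \<comment> \<open>The algebra \<open>\<D>\<close> is clopen, Borel and clopen in turn; it differs
    from \<open>\<A>\<close> in the open case.\<close>
  show ?thesis
    unfolding top
    using U_fin_if_S_fin_square[OF C.algebra_axioms z open_Union
        open_cover_clopen_refinement[OF assms(1)] openI]
      U_fin_if_S_fin_square[OF B.algebra_axioms z B.finite_Union Covers_enumeration[OF _ ne] borelI]
      U_fin_if_S_fin_square[OF C.algebra_axioms z C.finite_Union Covers_enumeration[OF _ ne] clopenI]
    by blast
qed

end
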